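(* Let $(a(n))$ be the almost Golomb sequence of order $5$. For all $n\ge 3$: $$a(5n)=T_5(n)+2+\varepsilon(n),$$ $$a(5n+1)=T_5(n+1)+1-\varepsilon(n),$$ $$a(5n+2)=T_5(n+2)-1-\eta(n),$$ $$a(5n+3)=T_5(n+3)-4+\theta(n),$$ $$a(5n+4)=T_5(n+4)-2+\varepsilon_4(n),$$ where $\theta(n)\in\{0,1\}$ and $\varepsilon_4(n)\in\{-4,-3,-2\}$ are both $5$-automatic sequences, expressed as the following explicit functions of $U=(\varepsilon,\eta)$ for indices $5m+d$ with $m\ge 3$, $0\le d\le 4$. (a) $\bigl(\theta(5m),\theta(5m+1),\theta(5m+2),\theta(5m+3),\theta(5m+4)\bigr)$ equals $(1,1,1,1,1)$ if $(U(m-1),U(m))$ is $((0,0),(0,0))$ or $((1,0),(0,0))$; equals $(0,1,0,1,0)$ if $(U(m-1),U(m))$ is $((0,0),(0,1))$ or $((1,0),(0,1))$; equals $(1,0,1,0,1)$ if $(U(m-1),U(m))=((0,1),(1,0))$; and no other pair $(U(m-1),U(m))$ occurs. (b) With $\sigma(m)=\varepsilon(m)+\eta(m)$: $\varepsilon_4(5m+d)=-2-\sigma(m)-\varepsilon(m)$ for $d\in\{0,2\}$ and $\varepsilon_4(5m+d)=-2-\sigma(m)-\eta(m)$ for $d\in\{1,3\}$; and $\varepsilon_4(5m+4)$ equals $-2$ if $(U(m),U(m+1))=((0,0),(0,0))$, equals $-3$ if $(U(m),U(m+1))$ is $((0,0),(0,1))$, $((0,1),(1,0))$ or $((1,0),(0,0))$,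 and equals $-4$ if $(U(m),U(m+1))=((1,0),(0,1))$. Consequently, $(a(n))$ is $5$-regular.
   Context: Consider nondecreasing sequences of positive integers $(a(n))_{n\ge 1}$, extended by $a(k)=0$ for $k\le 0$, such that (1) $a\bigl(a(n)+a(n-1)+a(n-2)+a(n-3)+a(n-4)\bigr)=n$ for every $n\ge 1$; and (2) for every $n\ge 2$, no integer $m$ with $a(n-1)\le m<a(n)$ satisfies $a\bigl(m+a(n-1)+a(n-2)+a(n-3)+a(n-4)\bigr)=n$. The almost Golomb sequence of order $5$ is the earliest such sequence, i.e. the lexicographically smallest among the sequences satisfying (1) and (2). Set $T_5(m):=a(m)+a(m-1)+a(m-2)+a(m-3)+a(m-4)$. For $n\ge 3$ define $\varepsilon(n):=a(5n)-T_5(n)-2$ and $\eta(n):=T_5(n+2)-1-a(5n+2)$; put $\varepsilon(1)=\varepsilon(2)=\eta(1)=\eta(2)=0$, and $U(n):=(\varepsilon(n),\eta(n))$. The sequences $\theta(n)$ and $\varepsilon_4(n)$, $n\ge 3$, are defined by the fourth and fifth displayed identities of the claim. The $5$-kernel of $(f(n))_{n\ge0}$ is $\{(f(5^i n+j))_{n\ge 0}: i\ge 0,\ 0\le j<5^i\}$. A sequence with values in a finite set is $5$-automatic if its $5$-kernel is finite; an integer-valued sequence is $5$-regular if the $\mathbb{Z}$-module spanned by its $5$-kernel is finitely generated. Values of $\theta,\varepsilon_4$ at $n<3$ are irrelevant and may be set arbitrarily.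
   Formalization: Condition (2) is imposed for n ≥ 3 instead of n ≥ 2: at n = 2 it contradicts (1), which forces a(1)=1 and a(2)=2, and then m=1 gives a(m+a(1))=2, so no sequence would satisfy the conditions as written. *)

theory Defs
  imports Complex_Main "HOL-Library.Function_Algebras"
begin

section \<open>The almost Golomb sequence of order 5\<close>

text \<open>
  Sequences indexed from 1 and extended by 0 are functions on all integers, so that the shifted
  arguments below are ordinary integer subtractions.
\<close>

definition T5_of :: "(int \<Rightarrow> int) \<Rightarrow> int \<Rightarrow> int" where
  "T5_of a n = a n + a (n - 1) + a (n - 2) + a (n - 3) + a (n - 4)"

text \<open>
  The last conjunct (no smaller candidate \<open>m\<close> for the value at \<open>n\<close>) is imposed from \<open>n = 3\<close> on.
  It is often phrased for \<open>n \<ge> 2\<close>, but at \<open>n = 2\<close>, read literally, it contradicts the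
  other conjuncts, see \<open>minimality_fails_at_2\<close> below: they force \<open>a 1 = 1\<close> and
  \<open>a 2 = 2\<close>, and then \<open>m = 1\<close> has \<open>a (m + a 1) = 2\<close>.
\<close>

definition golomb5_admissible :: "(int \<Rightarrow> int) \<Rightarrow> bool" where
  "golomb5_admissible a \<longleftrightarrow>
     (\<forall>k\<le>0. a k = 0) \<and>
     (\<forall>n\<ge>1. a n > 0) \<and>
     mono_on {1..} a \<and>
     (\<forall>n\<ge>1. a (a n + a (n - 1) + a (n - 2) + a (n - 3) + a (n - 4)) = n) \<and>
     (\<forall>n\<ge>3. \<not> (\<exists>m. a (n - 1) \<le> m \<and> m < a n \<and>
        a (m + a (n - 1) + a (n - 2) + a (n - 3) + a (n - 4)) = n))"

lemma minimality_fails_at_2: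
  assumes "golomb5_admissible a"
  shows "\<exists>m. a (2 - 1) \<le> m \<and> m < a 2 \<and>
           a (m + a (2 - 1) + a (2 - 2) + a (2 - 3) + a (2 - 4)) = 2"
proof -
  have z: "a k = 0" if "k \<le> 0" for k
    using assms that by (auto simp: golomb5_admissible_def)
  have p: "a n > 0" if "n \<ge> 1" for n
    using assms that by (auto simp: golomb5_admissible_def)
  have mon: "a m \<le> a n" if "1 \<le> m" "m \<le> n" for m n
    using assms that by (auto simp: golomb5_admissible_def mono_on_def)
  have eq: "a (a n + a (n - 1) + a (n - 2) + a (n - 3) + a (n - 4)) = n" if "n \<ge> 1" for n
    using assms that by (auto simp: golomb5_admissible_def)
  have "a (a 1) = 1" using eq[of 1] z by simp
  then have a1: "a 1 = 1" using mon[of 1 "a 1"] p[of 1] by simp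
  have e2: "a (a 2 + 1) = 2" using eq[of 2] z a1 by simp
  have "a 2 \<noteq> 1" using e2 by auto
  moreover have "a 2 \<le> 2" using mon[of 2 "a 2 + 1"] p[of 2] e2 by simp
  ultimately have "a 2 = 2" using p[of 2] by simp
  then show ?thesis using a1 z by (intro exI[of _ 1]) simp
qed

definition lex_smaller :: "(int \<Rightarrow> int) \<Rightarrow> (int \<Rightarrow> int) \<Rightarrow> bool" where
  "lex_smaller a b \<longleftrightarrow> (\<exists>n\<ge>1. (\<forall>k. 1 \<le> k \<and> k < n \<longrightarrow> a k = b k) \<and> a n < b n)"

definition is_almost_golomb5 :: "(int \<Rightarrow> int) \<Rightarrow> bool" where
  "is_almost_golomb5 a \<longleftrightarrow>
     golomb5_admissible a \<and> (\<forall>b. golomb5_admissible b \<and> b \<noteq> a \<longrightarrow> lex_smaller a b)"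

definition ag5 :: "int \<Rightarrow> int" where
  "ag5 = (THE a. is_almost_golomb5 a)"

abbreviation T5 :: "int \<Rightarrow> int" where
  "T5 \<equiv> T5_of ag5"


section \<open>The correction sequences\<close>

definition eps :: "nat \<Rightarrow> int" where
  "eps n = (if n \<ge> 3 then ag5 (5 * int n) - T5 (int n) - 2 else 0)"

definition eta :: "nat \<Rightarrow> int" where
  "eta n = (if n \<ge> 3 then T5 (int n + 2) - 1 - ag5 (5 * int n + 2) else 0)"

definition U :: "nat \<Rightarrow> int \<times> int" where
  "U n = (eps n, eta n)"

definition sigma :: "nat \<Rightarrow> int" where
  "sigma n = eps n + eta n"


section \<open>Automatic and regular sequences\<close>

definition kernel_of :: "nat \<Rightarrow> (nat \<Rightarrow> 'a) \<Rightarrow> (nat \<Rightarrow> 'a) set" where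
  "kernel_of k f = {(\<lambda>n. f (k ^ i * n + j)) | i j. j < k ^ i}"

definition automatic :: "nat \<Rightarrow> (nat \<Rightarrow> 'a) \<Rightarrow> bool" where
  "automatic k f \<longleftrightarrow> finite (range f) \<and> finite (kernel_of k f)"

definition seq_scale :: "int \<Rightarrow> (nat \<Rightarrow> int) \<Rightarrow> (nat \<Rightarrow> int)" where
  "seq_scale c f = (\<lambda>n. c * f n)"

interpretation int_seq: module seq_scale
  by unfold_locales (auto simp: seq_scale_def fun_eq_iff algebra_simps)

definition regular :: "nat \<Rightarrow> (nat \<Rightarrow> int) \<Rightarrow> bool" where
  "regular k f \<longleftrightarrow> (\<exists>B. finite B \<and> int_seq.span B = int_seq.span (kernel_of k f))"

end

theory Submission imports Defs "HOL-Library.FuncSet" begin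

text \<open>
  The whole sequence is governed by one binary sequence \<open>corr\<close>: for \<open>n \<ge> 3\<close> the value \<open>n\<close> is
  taken \<open>2 + corr n\<close> times, and in the notation of the statement
  \<open>\<epsilon>(n) = corr n\<close> and \<open>\<eta>(n) = corr (n + 1)\<close>. This sequence has no two consecutive ones and obeys
  \<open>corr (5m+1) = corr (5m+3) = corr (5m+5) = corr m\<close> and
  \<open>corr (5m+2) = corr (5m+4) = corr (m+1)\<close> for \<open>m \<ge> 3\<close>.

  The proof runs backwards: \<open>corr\<close> is defined by this recursion and its seeds, the
  increments
  \<open>jump (5n), \<dots>, jump (5n+4)\<close> of the sequence are read off as
  \<open>corr n, 1 - corr n, corr n, corr (n+1), 1 - corr (n+1)\<close> for \<open>n \<ge> 3\<close>, and \<open>gol\<close> is their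
  partial sum.
  Five consecutive increments around \<open>n\<close> add up to \<open>2 + corr n\<close>
  (\<open>jump_window\<close>). Since this is the increment of \<open>T\<^sub>5\<close> at \<open>n\<close>, summation expresses
  \<open>gol (5n), \<dots>, gol (5n+4)\<close> through \<open>T\<^sub>5(n)\<close>, \<open>corr n\<close> and \<open>corr (n+1)\<close> (\<open>gol_block\<close>).

  The self-reference \<open>gol (T\<^sub>5(n)) = n\<close>, with a jump at that position
  (\<open>gol_jumps_at_TG\<close>), is where the number 5 enters. If it holds below \<open>n\<close> and
  \<open>n = T\<^sub>5(m) + i\<close> with \<open>0 \<le> i < 2 + corr m\<close>, then the five values summed in \<open>T\<^sub>5(n)\<close> all lie
  among \<open>m\<close>, \<open>m - 1\<close>, \<open>m - 2\<close>, so \<open>T\<^sub>5(n)\<close> differs from \<open>5m\<close> by a bounded amount that \<open>i\<close>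
  and \<open>corr (m - 1)\<close> determine; there \<open>gol_block\<close> gives the value
  \<open>T\<^sub>5(m) + i = n\<close>.

  Hence \<open>gol\<close> is admissible. It is the least such sequence because it jumps as late as possible:
  any admissible \<open>b\<close> that agrees with \<open>gol\<close> below \<open>k \<ge> 3\<close> satisfies \<open>b (T\<^sub>5(n)) = n\<close> for \<open>n = gol k < k\<close>,
  where \<open>T\<^sub>5(n) \<le> k\<close>, so \<open>b k \<ge> n\<close> by monotonicity.

  All correction terms are now functions of a few neighbouring bits,
  \<open>\<theta>(n) = 1 - corr (n+2)\<close> and \<open>\<epsilon>\<^sub>4(n) = -2 - corr (n+1) - corr (n+2) - corr (n+3)\<close>,
  and the tables follow from the recursion. A bounded window of \<open>corr\<close> around \<open>5n + j\<close> depends only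
  on the window around \<open>n\<close>, which yields automaticity; regularity follows
  because the shifts of \<open>gol\<close> by \<open>0, \<dots>, 5\<close> together with the indicator functions of the
  windows span a module that is closed under passing to arithmetic progressions modulo 5.
\<close>

section \<open>The binary correction sequence\<close>

text \<open>
  On its own the recursion would produce only zeros. The three ones below 16 violate it; they are the
  seeds, read off from the initial terms of the almost Golomb sequence.
\<close>

function corr :: "int \<Rightarrow> int" where
  "corr n = (if n < 16 then of_bool (n \<in> {4, 13, 15})
             else if (n - 1) mod 5 \<in> {0, 2, 4} then corr ((n - 1) div 5)
             else corr ((n - 1) div 5 + 1))"
  by pat_completeness auto
termination by (relation "measure nat") auto

declare corr.simps [simp del]

lemma corr_small: "n < 16 \<Longrightarrow> corr n = of_bool (n \<in> {4, 13, 15})"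
  by (simp add: corr.simps)

lemma corr_rec:
  assumes "m \<ge> 3"
  shows "corr (5 * m + 1) = corr m" "corr (5 * m + 2) = corr (m + 1)"
    "corr (5 * m + 3) = corr m" "corr (5 * m + 4) = corr (m + 1)"
    "corr (5 * m + 5) = corr m"
proof -
  have q: "(5 * m + 1) div 5 = m" "(5 * m + 2) div 5 = m"
      "(5 * m + 3) div 5 = m" "(5 * m + 4) div 5 = m"
      "(5 * m + 1) mod 5 = 1" "(5 * m + 2) mod 5 = 2"
      "(5 * m + 3) mod 5 = 3" "(5 * m + 4) mod 5 = 4"
    by presburger+
  show "corr (5 * m + 1) = corr m" "corr (5 * m + 2) = corr (m + 1)"
    "corr (5 * m + 3) = corr m" "corr (5 * m + 4) = corr (m + 1)"
    "corr (5 * m + 5) = corr m"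
    using assms by (subst corr.simps; simp add: q)+
qed

lemma corr_01: "corr n \<in> {0, 1}"
  by (induction n rule: corr.induct) (subst corr.simps, simp)

lemma mod5_cases:
  obtains m :: int where "n = 5 * m + 1" | m where "n = 5 * m + 2" | m where "n = 5 * m + 3"
    | m where "n = 5 * m + 4" | m where "n = 5 * m + 5"
proof -
  have "n = 5 * ((n - 1) div 5) + 1 + (n - 1) mod 5" by presburger
  moreover have "(n - 1) mod 5 \<in> {0, 1, 2, 3, 4}" by auto
  ultimately show thesis using that[of "(n - 1) div 5"] by (smt (verit) insert_iff singletonD)
qed

text \<open>
  Two adjacent bits at \<open>n \<ge> 16\<close> are the bits at some \<open>m\<close> and \<open>m + 1\<close>, with \<open>5m < n\<close>, in one or the
  other order.
\<close>
lemma corr_no_consecutive: "corr n * corr (n + 1) = 0"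
proof (induction "nat n" arbitrary: n rule: less_induct)
  case less
  show ?case
  proof (cases "n < 16")
    case True
    then show ?thesis
      by (cases "n = 15") (auto simp: corr_small corr_rec(1)[of 3, simplified])
  next
    case False
    have IH: "corr m * corr (m + 1) = 0" if "5 * m < n" for m
      using that False by (intro less) auto
    have nxt: "corr (5 * m + 6) = corr (m + 1)" if "m \<ge> 3" for m
      using corr_rec(1)[of "m + 1"] that by (simp add: algebra_simps)
    obtain m where m: "n \<in> {5 * m + 1, 5 * m + 2, 5 * m + 3, 5 * m + 4, 5 * m + 5}"
      by (cases n rule: mod5_cases) auto
    then have "m \<ge> 3" "5 * m < n" using False by auto
    then have "corr n = corr m \<and> corr (n + 1) = corr (m + 1) \<or>
        corr n = corr (m + 1) \<and> corr (n + 1) = corr m"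
      using m corr_rec[of m] nxt[of m] by (auto simp: add.commute add.left_commute)
    then show ?thesis using IH[of m] \<open>5 * m < n\<close> by (auto simp: mult.commute)
  qed
qed

section \<open>The sequence with prescribed increments\<close>

definition jump :: "int \<Rightarrow> int" where
  "jump k = (if k < 15 then of_bool (k \<in> {1, 2, 5, 7, 10, 12, 14})
     else let n = k div 5 in
       [corr n, 1 - corr n, corr n, corr (n + 1), 1 - corr (n + 1)] ! nat (k mod 5))"

lemma jump_block:
  assumes "n \<ge> 3"
  shows "jump (5 * n) = corr n" "jump (5 * n + 1) = 1 - corr n" "jump (5 * n + 2) = corr n"
    "jump (5 * n + 3) = corr (n + 1)" "jump (5 * n + 4) = 1 - corr (n + 1)"
proof -
  have q: "(5 * n + 1) div 5 = n" "(5 * n + 2) div 5 = n"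
      "(5 * n + 3) div 5 = n" "(5 * n + 4) div 5 = n"
      "(5 * n + 1) mod 5 = 1" "(5 * n + 2) mod 5 = 2"
      "(5 * n + 3) mod 5 = 3" "(5 * n + 4) mod 5 = 4"
    by presburger+
  show "jump (5 * n) = corr n" "jump (5 * n + 1) = 1 - corr n" "jump (5 * n + 2) = corr n"
    "jump (5 * n + 3) = corr (n + 1)" "jump (5 * n + 4) = 1 - corr (n + 1)"
    using assms by (simp_all add: jump_def q)
qed

lemma jump_01: "jump k \<in> {0, 1}"
proof (cases "k < 15")
  case True
  moreover have "of_bool P \<in> {0, 1 :: int}" for P by (cases P) simp_all
  ultimately show ?thesis by (simp only: jump_def if_True)
next
  case False
  have "k mod 5 = 0 \<or> k mod 5 = 1 \<or> k mod 5 = 2 \<or> k mod 5 = 3 \<or> k mod 5 = 4" by presburger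
  then show ?thesis
    using False corr_01[of "k div 5"] corr_01[of "k div 5 + 1"]
    by (auto simp: jump_def Let_def)
qed

definition gol :: "int \<Rightarrow> int" where
  "gol k = (\<Sum>i\<in>{1..k}. jump i)"

lemma gol_nonpos: "k \<le> 0 \<Longrightarrow> gol k = 0"
  by (simp add: gol_def)

lemma gol_step: "gol k = gol (k - 1) + jump k"
proof (cases "k \<le> 0")
  case True
  then show ?thesis by (auto simp: gol_nonpos jump_def)
next
  case False
  then have "{1..k} = insert k {1..k - 1}" by auto
  then show ?thesis by (simp add: gol_def)
qed

lemma gol_mono: "i \<le> k \<Longrightarrow> gol i \<le> gol k"
proof (induction k rule: int_ge_induct)
  case (step k)
  moreover have "jump (k + 1) \<ge> 0" using jump_01[of "k + 1"] by auto
  ultimately show ?case using gol_step[of "k + 1"] by simp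
qed simp

lemma gol_values:
  "gol 1 = 1" "gol 2 = 2" "gol 3 = 2" "gol 4 = 2" "gol 5 = 3" "gol 6 = 3" "gol 7 = 4"
  "gol 8 = 4" "gol 9 = 4" "gol 10 = 5" "gol 11 = 5" "gol 12 = 6" "gol 13 = 6" "gol 14 = 7"
  "gol 15 = 7" "gol 16 = 8" "gol 17 = 8" "gol 18 = 9"
proof -
  have j: "jump 15 = 0" "jump 16 = 1" "jump 17 = 0" "jump 18 = 1"
    using jump_block[of 3] by (simp_all add: corr_small)
  have v1: "gol 1 = 1" using gol_step[of 1] by (simp add: gol_nonpos jump_def)
  have v2: "gol 2 = 2" using gol_step[of 2] v1 by (simp add: jump_def)
  have v3: "gol 3 = 2" using gol_step[of 3] v2 by (simp add: jump_def)
  have v4: "gol 4 = 2" using gol_step[of 4] v3 by (simp add: jump_def)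
  have v5: "gol 5 = 3" using gol_step[of 5] v4 by (simp add: jump_def)
  have v6: "gol 6 = 3" using gol_step[of 6] v5 by (simp add: jump_def)
  have v7: "gol 7 = 4" using gol_step[of 7] v6 by (simp add: jump_def)
  have v8: "gol 8 = 4" using gol_step[of 8] v7 by (simp add: jump_def)
  have v9: "gol 9 = 4" using gol_step[of 9] v8 by (simp add: jump_def)
  have v10: "gol 10 = 5" using gol_step[of 10] v9 by (simp add: jump_def)
  have v11: "gol 11 = 5" using gol_step[of 11] v10 by (simp add: jump_def)
  have v12: "gol 12 = 6" using gol_step[of 12] v11 by (simp add: jump_def)
  have v13: "gol 13 = 6" using gol_step[of 13] v12 by (simp add: jump_def)
  have v14: "gol 14 = 7" using gol_step[of 14] v13 by (simp add: jump_def)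
  have v15: "gol 15 = 7" using gol_step[of 15] v14 j by simp
  have v16: "gol 16 = 8" using gol_step[of 16] v15 j by simp
  have v17: "gol 17 = 8" using gol_step[of 17] v16 j by simp
  have v18: "gol 18 = 9" using gol_step[of 18] v17 j by simp
  show "gol 1 = 1" "gol 2 = 2" "gol 3 = 2" "gol 4 = 2" "gol 5 = 3" "gol 6 = 3" "gol 7 = 4"
    "gol 8 = 4" "gol 9 = 4" "gol 10 = 5" "gol 11 = 5" "gol 12 = 6" "gol 13 = 6" "gol 14 = 7"
    "gol 15 = 7" "gol 16 = 8" "gol 17 = 8" "gol 18 = 9"
    by (simp_all only: v1 v2 v3 v4 v5 v6 v7 v8 v9 v10 v11 v12 v13 v14 v15 v16 v17 v18)
qed

abbreviation TG :: "int \<Rightarrow> int" where "TG \<equiv> T5_of gol"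

text \<open>
  From \<open>n = 20\<close> on, four of the five terms form two pairs \<open>x\<close>, \<open>1 - x\<close>, and the remaining one
  is the bit that the recursion assigns to \<open>n\<close>. Which blocks of increments the window meets depends
  on \<open>n\<close> modulo 5. Below 20 the seeds interfere.
\<close>
lemma jump_window:
  assumes "n \<ge> 3"
  shows "jump (n - 3) + jump (n - 2) + jump (n - 1) + jump n + jump (n + 1) = 2 + corr n"
proof (cases "n < 20")
  case True
  have b: "jump 15 = 0" "jump 16 = 1" "jump 17 = 0" "jump 18 = 1" "jump 19 = 0" "jump 20 = 1"
    using jump_block[of 3] jump_block(1)[of 4] by (simp_all add: corr_small)
  have c: "corr 16 = 0" "corr 17 = 1" "corr 18 = 0" "corr 19 = 1"
    using corr_rec[of 3] by (simp_all add: corr_small)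
  from True assms have "n \<in> {3, 4, 5, 6, 7, 8, 9, 10, 11, 12, 13, 14, 15, 16, 17, 18, 19}" by simp arith
  then show ?thesis
    by (elim insertE emptyE; hypsubst; simp add: b c; simp add: jump_def corr_small)
next
  case False
  define m where "m = n div 5"
  have m: "m \<ge> 4" using False by (auto simp: m_def)
  have p: "jump (5 * m - 3) = corr (m - 1)" "jump (5 * m - 2) = corr m"
      "jump (5 * m - 1) = 1 - corr m" "corr (5 * m) = corr (m - 1)"
    using jump_block[of "m - 1"] corr_rec(5)[of "m - 1"] m by (simp_all add: algebra_simps)
  have s: "jump (5 * m + 5) = corr (m + 1)"
    using jump_block(1)[of "m + 1"] m by (simp add: algebra_simps)
  have "n = 5 * m + n mod 5" by (simp add: m_def)
  moreover have "n mod 5 \<in> {0, 1, 2, 3, 4}" by auto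
  ultimately consider "n = 5 * m" | "n = 5 * m + 1" | "n = 5 * m + 2" | "n = 5 * m + 3"
    | "n = 5 * m + 4" by fastforce
  then show ?thesis
    using m p s jump_block[of m] corr_rec[of m] by cases (simp_all add: algebra_simps)
qed

lemma TG_step: "n \<ge> 3 \<Longrightarrow> TG (n + 1) = TG n + 2 + corr n"
  using jump_window[of n] gol_step[of "n + 1"] gol_step[of n] gol_step[of "n - 1"]
    gol_step[of "n - 2"] gol_step[of "n - 3"]
  by (simp add: T5_of_def algebra_simps)

text \<open>
  By \<open>TG_step\<close>, the first identity telescopes: \<open>gol\<close> grows by \<open>2 + corr (n + 1)\<close>
  from \<open>5n\<close> to \<open>5(n + 1)\<close>, which is the growth of \<open>TG n + corr n\<close>.
\<close>
lemma gol_block: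
  assumes "n \<ge> 3"
  shows "gol (5 * n) = TG n + 2 + corr n" "gol (5 * n + 1) = TG n + 3"
    "gol (5 * n + 2) = TG n + 3 + corr n" "gol (5 * n + 3) = TG n + 3 + corr n + corr (n + 1)"
    "gol (5 * n + 4) = TG n + 4 + corr n"
proof -
  have s: "gol (5 * m + 1) = gol (5 * m) + 1 - corr m" "gol (5 * m + 2) = gol (5 * m) + 1"
     "gol (5 * m + 3) = gol (5 * m) + 1 + corr (m + 1)" "gol (5 * m + 4) = gol (5 * m) + 2"
     "gol (5 * (m + 1)) = gol (5 * m) + 2 + corr (m + 1)" if "m \<ge> 3" for m
    using that gol_step[of "5 * m + 1"] gol_step[of "5 * m + 2"] gol_step[of "5 * m + 3"]
      gol_step[of "5 * m + 4"] gol_step[of "5 * (m + 1)"] jump_block[of m] jump_block(1)[of "m + 1"]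
    by (simp_all add: algebra_simps)
  show z: "gol (5 * n) = TG n + 2 + corr n"
    using assms
  proof (induction n rule: int_ge_induct)
    case base
    then show ?case by (simp add: T5_of_def gol_values gol_nonpos corr_small)
  next
    case (step m)
    then show ?case using s(5)[of m] TG_step[of m] by simp
  qed
  show "gol (5 * n + 1) = TG n + 3"
    "gol (5 * n + 2) = TG n + 3 + corr n" "gol (5 * n + 3) = TG n + 3 + corr n + corr (n + 1)"
    "gol (5 * n + 4) = TG n + 4 + corr n"
    using s[of n] z assms by simp_all
qed

section \<open>The self-referential equation\<close>

lemma TG_5: "TG 5 = 10"
  by (simp add: T5_of_def gol_values)

lemma TG_ge: "n \<ge> 5 \<Longrightarrow> TG n \<ge> 2 * n"
proof (induction n rule: int_ge_induct)
  case (step n)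
  then show ?case using TG_step[of n] corr_01[of n] by auto
qed (simp add: TG_5)

lemma TG_bracket:
  assumes "n \<ge> 10"
  obtains m where "m \<ge> 5" "TG m \<le> n" "n < TG (m + 1)"
proof -
  have "\<exists>m\<ge>5. TG m \<le> n \<and> n < TG (m + 1)"
    using assms
  proof (induction n rule: int_ge_induct)
    case base
    then show ?case
      using TG_step[of 5] by (intro exI[of _ 5]) (simp add: TG_5 corr_small)
  next
    case (step n)
    then obtain m where m: "m \<ge> 5" "TG m \<le> n" "n < TG (m + 1)" by blast
    then show ?case
      using TG_step[of "m + 1"] corr_01[of "m + 1"]
      by (cases "n + 1 < TG (m + 1)") (force, intro exI[of _ "m + 1"], auto)
  qed
  then show ?thesis using that by blast
qed

text \<open>
  Together the two equations say that \<open>n\<close> first appears at position \<open>TG n\<close>. The second one is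
  what the minimality condition needs, and in the induction it turns the equations at \<open>i\<close> and
  \<open>i + 1\<close> into full knowledge of where \<open>gol\<close> equals \<open>i\<close>.
\<close>
lemma gol_jumps_at_TG:
  "n \<ge> 3 \<Longrightarrow> gol (TG n) = n \<and> gol (TG n - 1) = n - 1"
proof (induction "nat n" arbitrary: n rule: less_induct)
  case less
  show ?case
  proof (cases "n < 10")
    case True
    then have "n \<in> {3, 4, 5, 6, 7, 8, 9}" using less.prems by auto
    then show ?thesis
      by (elim insertE emptyE; simp add: T5_of_def gol_values gol_nonpos)
  next
    case False
    then obtain m where m: "m \<ge> 5" "TG m \<le> n" "n < TG (m + 1)" using TG_bracket[of n] by auto
    have IH: "gol (TG i) = i" "gol (TG i - 1) = i - 1" if "3 \<le> i" "i \<le> m + 1" for i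
      using less.hyps[of i] that m TG_ge[of m] by auto
    \<comment> \<open>By monotonicity, \<open>gol\<close> is constant between consecutive jump positions.\<close>
    have plateau: "gol k = i" if "3 \<le> i" "i \<le> m" "TG i \<le> k" "k < TG (i + 1)" for i k
      using IH(1)[of i] IH(2)[of "i + 1"] gol_mono[of "TG i" k] gol_mono[of k "TG (i + 1) - 1"] that
      by auto
    have st: "TG (m + 1) = TG m + 2 + corr m" "TG m = TG (m - 1) + 2 + corr (m - 1)"
        "TG (m - 1) = TG (m - 2) + 2 + corr (m - 2)"
      using TG_step[of m] TG_step[of "m - 1"] TG_step[of "m - 2"] m by (simp_all add: algebra_simps)
    have c: "corr m \<in> {0, 1}" "corr (m - 1) \<in> {0, 1}" "corr (m - 2) \<in> {0, 1}"
      using corr_01 by auto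
    have cc: "corr (m - 1) * corr m = 0" using corr_no_consecutive[of "m - 1"] by simp
    \<comment> \<open>The values next to \<open>TG m\<close>, since \<open>m - 1\<close> and \<open>m - 2\<close> occur
        \<open>2 + corr (m - 1)\<close> and at least two times.\<close>
    have lo: "gol (TG m - 1) = m - 1" "gol (TG m - 2) = m - 1" 
        "gol (TG m - 3) = m - 2 + corr (m - 1)" "gol (TG m - 4) = m - 2"
      using plateau[of "m - 1" "TG m - 1"] plateau[of "m - 1" "TG m - 2"]
        plateau[of "m - 1" "TG m - 3"] plateau[of "m - 2" "TG m - 3"] plateau[of "m - 2" "TG m - 4"]
        st c m by auto
    have hi: "gol (TG m) = m" "gol (TG m + 1) = m"
      using plateau[of m "TG m"] plateau[of m "TG m + 1"] st c m by auto
    note b = gol_block[of "m - 2"] gol_block[of "m - 1"]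
    note j = jump_block[of "m - 2"] jump_block[of "m - 1"]
    \<comment> \<open>\<open>n\<close> lies in the run of positions where \<open>gol\<close> is \<open>m\<close>; the run has length 2 or 3.\<close>
    have "corr m = 0 \<or> corr m = 1" using c(1) by simp
    then consider "n = TG m" | "n = TG m + 1" | "n = TG m + 2" "corr m = 1"
      using m(2,3) st(1) by linarith
    then show ?thesis
    proof cases
      case 1
      \<comment> \<open>The five values are \<open>m\<close>, twice \<open>m - 1\<close>, \<open>m - 2 + corr (m - 1)\<close> and \<open>m - 2\<close>.\<close>
      have k: "TG n = 5 * m - 6 + corr (m - 1)"
        using 1 hi lo by (simp add: T5_of_def)
      have "gol (5 * m - 6 + corr (m - 1)) = TG m \<and> jump (5 * m - 6 + corr (m - 1)) = 1"
        using b j c st m by (auto simp: algebra_simps)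
      then show ?thesis using 1 k gol_step[of "TG n"] by simp
    next
      case 2
      have k: "TG n = 5 * m - 4 + corr (m - 1)"
        using 2 hi lo by (simp add: T5_of_def algebra_simps)
      have "gol (5 * m - 4 + corr (m - 1)) = TG m + 1 \<and> jump (5 * m - 4 + corr (m - 1)) = 1"
        using b j c st m by (auto simp: algebra_simps)
      then show ?thesis using 2 k gol_step[of "TG n"] by simp
    next
      case 3
      then have "gol n = m" using plateau[of m n] m st by simp
      then have k: "TG n = 5 * m - 2"
        using 3 hi lo by (simp add: T5_of_def algebra_simps)
      have "corr (m - 1) = 0" using 3 cc by simp
      then have "gol (5 * m - 2) = TG m + 2 \<and> jump (5 * m - 2) = 1"
        using 3 b j st m by (auto simp: algebra_simps)
      then show ?thesis using 3 k gol_step[of "TG n"] by simp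
    qed
  qed
qed

section \<open>Admissibility and lexicographic minimality\<close>

lemma gol_eq_iff: 
  assumes "n \<ge> 3"
  shows "gol k = n \<longleftrightarrow> TG n \<le> k \<and> k < TG (n + 1)"
proof -
  have "gol (TG n) = n" "gol (TG n - 1) = n - 1" "gol (TG (n + 1)) = n + 1"
      "gol (TG (n + 1) - 1) = n"
    using gol_jumps_at_TG[of n] gol_jumps_at_TG[of "n + 1"] assms by auto
  then show ?thesis
    using gol_mono[of k "TG n - 1"] gol_mono[of "TG n" k] gol_mono[of k "TG (n + 1) - 1"]
      gol_mono[of "TG (n + 1)" k] by linarith
qed

lemma gol_pos: "n \<ge> 1 \<Longrightarrow> gol n > 0"
  using gol_mono[of 1 n] by (simp add: gol_values)

lemma gol_TG: "n \<ge> 1 \<Longrightarrow> gol (TG n) = n"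
proof (cases "n \<ge> 3")
  case False
  assume "n \<ge> 1"
  with False have "n = 1 \<or> n = 2" by linarith
  then show ?thesis by (elim disjE) (simp_all add: T5_of_def gol_values gol_nonpos)
qed (simp add: gol_jumps_at_TG)

lemma gol_admissible: "golomb5_admissible gol"
  unfolding golomb5_admissible_def
proof (intro conjI allI impI)
  fix n :: int
  assume "n \<ge> 1"
  then show "gol (gol n + gol (n - 1) + gol (n - 2) + gol (n - 3) + gol (n - 4)) = n"
    using gol_TG[of n] by (simp add: T5_of_def)
next
  fix n :: int
  assume n: "n \<ge> 3"
  show "\<not> (\<exists>m\<ge>gol (n - 1). m < gol n \<and>
      gol (m + gol (n - 1) + gol (n - 2) + gol (n - 3) + gol (n - 4)) = n)"
  proof
    assume "\<exists>m\<ge>gol (n - 1). m < gol n \<and>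
      gol (m + gol (n - 1) + gol (n - 2) + gol (n - 3) + gol (n - 4)) = n"
    then obtain m where m: "m < gol n"
      "gol (m + gol (n - 1) + gol (n - 2) + gol (n - 3) + gol (n - 4)) = n" by blast
    then have "TG n \<le> m + gol (n - 1) + gol (n - 2) + gol (n - 3) + gol (n - 4)"
      using gol_eq_iff[of n] n by simp
    then show False using m(1) by (simp add: T5_of_def)
  qed
qed (auto simp: gol_nonpos gol_pos mono_on_def gol_mono)

lemma gol_less: "k \<ge> 3 \<Longrightarrow> gol k < k"
proof (induction k rule: int_ge_induct)
  case base
  then show ?case by (simp add: gol_values)
next
  case (step k)
  have "jump (k + 1) \<le> 1" using jump_01[of "k + 1"] by auto
  then show ?case using step gol_step[of "k + 1"] by simp
qed

text \<open>
  The equation for \<open>n = gol k\<close> forces \<open>b\<close> to reach \<open>n\<close> at position \<open>TG n \<le> k\<close>, a position that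
  depends only on values of \<open>b\<close> at arguments below \<open>k\<close>. This needs \<open>n < k\<close>, which fails for
  \<open>k \<le> 2\<close>; there positivity and the equation at 2 give the bound.
\<close>
lemma admissible_ge_gol:
  assumes adm: "golomb5_admissible b" and k: "k \<ge> 1"
    and agree: "\<And>i. 1 \<le> i \<Longrightarrow> i < k \<Longrightarrow> b i = gol i"
  shows "gol k \<le> b k"
proof -
  have z: "b i = 0" if "i \<le> 0" for i
    using adm that by (auto simp: golomb5_admissible_def)
  have mon: "b i \<le> b j" if "1 \<le> i" "i \<le> j" for i j
    using adm that by (auto simp: golomb5_admissible_def mono_on_def)
  have pos: "b i > 0" if "i \<ge> 1" for i
    using adm that by (auto simp: golomb5_admissible_def)
  have eq: "b (T5_of b i) = i" if "i \<ge> 1" for i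
    using adm that by (auto simp: golomb5_admissible_def T5_of_def)
  consider "k = 1" | "k = 2" | "k \<ge> 3" using k by linarith
  then show ?thesis
  proof cases
    case 1
    then show ?thesis using pos[of 1] by (simp add: gol_values)
  next
    case 2
    then have b1: "b 1 = 1" using agree[of 1] by (simp add: gol_values)
    have "b (b 2 + 1) = 2" using eq[of 2] z b1 by (simp add: T5_of_def)
    then have "b 2 \<noteq> 1" by auto
    then show ?thesis using 2 pos[of 2] by (simp add: gol_values)
  next
    case 3
    define n where "n = gol k"
    have n: "1 \<le> n" "n < k" using gol_pos[of k] gol_less[of k] 3 by (simp_all add: n_def)
    have below: "b i = gol i" if "i \<le> n" for i
      using agree[of i] z[of i] gol_nonpos[of i] n that by linarith
    have "T5_of b n = TG n" using below by (simp add: T5_of_def)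
    moreover have "TG n \<le> k"
    proof (cases "n \<ge> 3")
      case True
      then show ?thesis using gol_eq_iff[of n k] by (simp add: n_def)
    next
      case False
      then have "n = 1 \<or> n = 2" using n by linarith
      then show ?thesis
        using 3 gol_mono[of 3 k]
        by (elim disjE) (simp_all add: T5_of_def gol_values gol_nonpos n_def)
    qed
    moreover have "T5_of b n \<ge> 1"
      using \<open>T5_of b n = TG n\<close> gol_mono[of 0 "n - 1"] gol_mono[of "-4" "n - 2"] gol_mono[of "-4" "n - 3"]
        gol_mono[of "-4" "n - 4"] gol_pos[of n] n by (simp add: T5_of_def gol_nonpos)
    ultimately have "b (TG n) \<le> b k" using mon by simp
    then show ?thesis using eq[of n] n \<open>T5_of b n = TG n\<close> by (simp add: n_def)
  qed
qed

lemma is_almost_golomb5_gol: "is_almost_golomb5 gol"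
  unfolding is_almost_golomb5_def
proof (intro conjI allI impI gol_admissible)
  fix b
  assume b: "golomb5_admissible b \<and> b \<noteq> gol"
  define P where "P j \<longleftrightarrow> b (int j) \<noteq> gol (int j)" for j :: nat
  have z: "b i = 0" if "i \<le> 0" for i
    using b that by (auto simp: golomb5_admissible_def)
  obtain i where i: "b i \<noteq> gol i" using b by blast
  then have "i \<ge> 1" using z[of i] gol_nonpos[of i] by linarith
  then have "P (nat i)" using i by (simp add: P_def)
  then have L: "P (LEAST j. P j)" by (rule LeastI)
  define k where "k = int (LEAST j. P j)"
  have k: "b k \<noteq> gol k" using L by (simp add: P_def k_def)
  then have k1: "k \<ge> 1" using z[of k] gol_nonpos[of k] by linarith
  have agree: "b j = gol j" if "1 \<le> j" "j < k" for j
    using not_less_Least[of "nat j" P] that by (simp add: k_def P_def nat_less_iff)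
  have "gol k < b k" using admissible_ge_gol[OF _ k1 agree] b k by force
  then show "lex_smaller gol b"
    unfolding lex_smaller_def using k1 agree by (intro exI[of _ k]) auto
qed

lemma lex_smaller_asym: "lex_smaller a b \<Longrightarrow> \<not> lex_smaller b a"
  unfolding lex_smaller_def
proof (rule notI, elim exE conjE)
  fix m n :: int
  assume "1 \<le> m" "\<forall>k. 1 \<le> k \<and> k < m \<longrightarrow> a k = b k" "a m < b m"
    "1 \<le> n" "\<forall>k. 1 \<le> k \<and> k < n \<longrightarrow> b k = a k" "b n < a n"
  then show False by (cases m n rule: linorder_cases) force+
qed

lemma ag5_eq_gol: "ag5 = gol"
  unfolding ag5_def
proof (rule the_equality)
  fix a
  assume "is_almost_golomb5 a"
  then show "a = gol"
    using is_almost_golomb5_gol lex_smaller_asym[of a gol]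
    unfolding is_almost_golomb5_def by metis
qed (rule is_almost_golomb5_gol)

section \<open>The correction sequences as windows of bits\<close>

lemma TG_shift:
  assumes "n \<ge> 3"
  shows "TG (n + 2) = TG n + 4 + corr n + corr (n + 1)"
    "TG (n + 3) = TG n + 6 + corr n + corr (n + 1) + corr (n + 2)"
    "TG (n + 4) = TG n + 8 + corr n + corr (n + 1) + corr (n + 2) + corr (n + 3)"
  using assms TG_step[of n] TG_step[of "n + 1"] TG_step[of "n + 2"] TG_step[of "n + 3"]
  by (simp_all add: algebra_simps)

lemma eps_eq: "eps n = corr (int n)"
  using gol_block(1)[of "int n"] by (simp add: eps_def ag5_eq_gol corr_small)

lemma eta_eq: "eta n = corr (int n + 1)"
proof (cases "n \<ge> 3")
  case True
  then show ?thesis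
    using gol_block(3)[of "int n"] TG_shift(1)[of "int n"]
    by (simp add: eta_def ag5_eq_gol)
next
  case False
  then show ?thesis by (simp add: eta_def corr_small)
qed

section \<open>Criteria for automatic and regular sequences\<close>

lemma state_iterate:
  fixes X :: "nat \<Rightarrow> 's"
  assumes step: "\<And>m n j. j < k \<Longrightarrow> X m = X n \<Longrightarrow> X (k * m + j) = X (k * n + j)"
    and "X m = X n" "j < k ^ i"
  shows "X (k ^ i * m + j) = X (k ^ i * n + j)"
  using assms(3)
proof (induction i arbitrary: j)
  case 0
  then show ?case using assms(2) by simp
next
  case (Suc i)
  have k: "k > 0" using Suc.prems by (cases k) auto
  have "j div k < k ^ i" using Suc.prems k by (simp add: less_mult_imp_div_less mult.commute)
  then have "X (k ^ i * m + j div k) = X (k ^ i * n + j div k)" by (rule Suc.IH)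
  from step[OF _ this, of "j mod k"] k show ?case by (simp add: algebra_simps)
qed

text \<open>
  The map \<open>X\<close> is a finite automaton reading base \<open>k\<close> digits, with \<open>f\<close> as output: every element of
  the kernel of \<open>f\<close> is a function of \<open>X\<close>, and there are only finitely many such functions
  with values in the range of \<open>f\<close>.
\<close>
lemma automaticI:
  fixes X :: "nat \<Rightarrow> 's"
  assumes fin: "finite (range X)"
    and step: "\<And>m n j. j < k \<Longrightarrow> X m = X n \<Longrightarrow> X (k * m + j) = X (k * n + j)"
    and out: "\<And>m n. X m = X n \<Longrightarrow> f m = f n"
  shows "automatic k f"
proof -
  have f: "f n = f (inv X (X n))" for n
    by (rule out) (simp add: f_inv_into_f)
  have finf: "finite (range f)"
  proof (rule finite_subset)
    show "range f \<subseteq> (\<lambda>s. f (inv X s)) ` range X" using f by blast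
  qed (use fin in simp)
  have "kernel_of k f \<subseteq> (\<lambda>h n. h (X n)) ` (range X \<rightarrow>\<^sub>E range f)"
  proof
    fix g
    assume "g \<in> kernel_of k f"
    then obtain i j where g: "g = (\<lambda>n. f (k ^ i * n + j))" and j: "j < k ^ i"
      by (auto simp: kernel_of_def)
    have dep: "g (inv X (X n)) = g n" for n
      unfolding g
      by (intro out state_iterate[where X = X and k = k, OF _ _ j] step) (simp_all add: f_inv_into_f)
    have "restrict (\<lambda>s. g (inv X s)) (range X) \<in> range X \<rightarrow>\<^sub>E range f"
      using g by auto
    moreover have "g = (\<lambda>n. restrict (\<lambda>s. g (inv X s)) (range X) (X n))"
      by (simp add: dep)
    ultimately show "g \<in> (\<lambda>h n. h (X n)) ` (range X \<rightarrow>\<^sub>E range f)" by blast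
  qed
  then have "finite (kernel_of k f)"
    by (rule finite_subset) (intro finite_imageI finite_PiE fin finf)
  then show ?thesis using finf by (simp add: automatic_def)
qed

lemma int_subgroup_principal:
  fixes I :: "int set"
  assumes "0 \<in> I" and diff: "\<And>c d q. c \<in> I \<Longrightarrow> d \<in> I \<Longrightarrow> c - q * d \<in> I"
  obtains d where "d \<in> I" "\<And>c. c \<in> I \<Longrightarrow> d dvd c"
proof (cases "I = {0}")
  case True
  then show ?thesis using that[of 0] by auto
next
  case False
  then obtain c where c: "c \<in> I" "c \<noteq> 0" using assms(1) by blast
  define P where "P n \<longleftrightarrow> n > 0 \<and> int n \<in> I" for n
  have "- c \<in> I" using diff[OF assms(1) c(1), of 1] by simp
  then have "P (nat \<bar>c\<bar>)" using c by (auto simp: P_def abs_if)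
  then have L: "P (LEAST n. P n)" by (rule LeastI)
  define d where "d = int (LEAST n. P n)"
  have d: "d > 0" "d \<in> I" using L by (simp_all add: P_def d_def)
  have "d dvd x" if "x \<in> I" for x
  proof -
    have "x mod d = x - (x div d) * d" by (simp add: minus_div_mult_eq_mod)
    then have m: "x mod d \<in> I" using diff[OF that d(2), of "x div d"] by simp
    have "\<not> P (nat (x mod d))"
      using d(1) by (intro not_less_Least) (simp add: d_def nat_less_iff)
    then have "\<not> x mod d > 0" using m by (simp add: P_def)
    then have "x mod d = 0" using pos_mod_sign[of d x] d(1) by linarith
    then show ?thesis by auto
  qed
  with d(2) show ?thesis using that by blast
qed

text \<open>
  The integers are a Noetherian ring, so that a submodule of a finitely generated module of
  integer sequences is finitely generated. The induction on the generators takes, for the ideal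
  of coefficients that a generator \<open>b\<close> has in the submodule, an element realising the generator
  \<open>d\<close> of that ideal.
\<close>
lemma subspace_of_span_finite:
  assumes "finite B" "int_seq.subspace N" "N \<subseteq> int_seq.span B"
  shows "\<exists>C. finite C \<and> int_seq.span C = N"
  using assms
proof (induction B arbitrary: N rule: finite_induct)
  case empty
  then have "N = {0}" using int_seq.subspace_0 by auto
  then show ?case by (intro exI[of _ "{}"]) simp
next
  case (insert b B)
  note sub = insert.prems(1)
  define I where "I = {c. \<exists>y\<in>N. y - seq_scale c b \<in> int_seq.span B}"
  have "0 \<in> I"
    using int_seq.subspace_0[OF sub] int_seq.span_zero[of B] by (auto simp: I_def intro!: bexI[of _ 0])
  moreover have "c - q * d \<in> I" if "c \<in> I" "d \<in> I" for c d q
  proof -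
    from that obtain y z where yz: "y \<in> N" "z \<in> N" "y - seq_scale c b \<in> int_seq.span B"
        "z - seq_scale d b \<in> int_seq.span B" by (auto simp: I_def)
    have "(y - seq_scale q z) - seq_scale (c - q * d) b =
        (y - seq_scale c b) - seq_scale q (z - seq_scale d b)"
      by (simp add: int_seq.scale_left_diff_distrib int_seq.scale_right_diff_distrib)
    also have "\<dots> \<in> int_seq.span B"
      by (intro int_seq.span_diff int_seq.span_scale yz)
    finally have "(y - seq_scale q z) - seq_scale (c - q * d) b \<in> int_seq.span B" .
    moreover have "y - seq_scale q z \<in> N"
      using sub yz by (intro int_seq.subspace_diff int_seq.subspace_scale)
    ultimately show ?thesis unfolding I_def by blast
  qed
  ultimately obtain d where d: "d \<in> I" "\<And>c. c \<in> I \<Longrightarrow> d dvd c"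
    using int_subgroup_principal by metis
  then obtain z where z: "z \<in> N" "z - seq_scale d b \<in> int_seq.span B" by (auto simp: I_def)
  have "int_seq.subspace (N \<inter> int_seq.span B)"
    using sub by (intro int_seq.subspace_inter int_seq.subspace_span)
  then obtain C where C: "finite C" "int_seq.span C = N \<inter> int_seq.span B"
    using insert.IH by blast
  have "int_seq.span (insert z C) = N"
  proof
    have "C \<subseteq> N" using C(2) int_seq.span_superset[of C] by blast
    then show "int_seq.span (insert z C) \<subseteq> N"
      using z sub by (intro int_seq.span_minimal) auto
    show "N \<subseteq> int_seq.span (insert z C)"
    proof
      fix y
      assume y: "y \<in> N"
      then obtain c where c: "y - seq_scale c b \<in> int_seq.span B"
        using insert.prems(2) int_seq.span_breakdown_eq by blast
      then have "c \<in> I" using y by (auto simp: I_def)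
      then have "d dvd c" by (rule d(2))
      then obtain q where q: "c = d * q" ..
      have "y - seq_scale q z = (y - seq_scale c b) - seq_scale q (z - seq_scale d b)"
        by (simp add: q int_seq.scale_right_diff_distrib mult.commute)
      also have "\<dots> \<in> int_seq.span B"
        by (intro int_seq.span_diff int_seq.span_scale c z)
      finally have "y - seq_scale q z \<in> int_seq.span C"
        using y z sub unfolding C(2) by (auto intro: int_seq.subspace_diff int_seq.subspace_scale)
      then show "y \<in> int_seq.span (insert z C)" using int_seq.span_breakdown_eq by blast
    qed
  qed
  then show ?case using C(1) by blast
qed

text \<open>
  A finitely generated module that contains \<open>f\<close> and is closed under \<open>g \<mapsto> g(kn + j)\<close> contains the whole
  kernel of \<open>f\<close>. The span of the kernel may be smaller, and is finitely generated as a submodule.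
\<close>
lemma regularI:
  assumes "finite G" "f \<in> int_seq.span G"
    and step: "\<And>g j. g \<in> G \<Longrightarrow> j < k \<Longrightarrow> (\<lambda>n. g (k * n + j)) \<in> int_seq.span G"
  shows "regular k f"
proof -
  have dec: "(\<lambda>n. g (k * n + j)) \<in> int_seq.span G" if "g \<in> int_seq.span G" "j < k" for g j
    using that(1)
  proof (induction rule: int_seq.span_induct_alt)
    case base
    then show ?case using int_seq.span_zero[of G] by (simp add: zero_fun_def)
  next
    case (step c x y)
    have "(\<lambda>n. (seq_scale c x + y) (k * n + j)) =
        seq_scale c (\<lambda>n. x (k * n + j)) + (\<lambda>n. y (k * n + j))"
      by (simp add: seq_scale_def plus_fun_def)
    then show ?case
      using step assms(3)[OF _ \<open>j < k\<close>] by (auto intro: int_seq.span_add int_seq.span_scale)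
  qed
  have ker: "(\<lambda>n. g (k ^ i * n + j)) \<in> int_seq.span G" if "g \<in> int_seq.span G" "j < k ^ i" for g i j
    using that
  proof (induction i arbitrary: g j)
    case 0
    then show ?case by simp
  next
    case (Suc i)
    have k: "k > 0" using Suc.prems by (cases k) auto
    have "j div k < k ^ i" using Suc.prems k by (simp add: less_mult_imp_div_less mult.commute)
    from Suc.IH[OF dec[OF Suc.prems(1), of "j mod k"] this] k
    show ?case by (simp add: algebra_simps)
  qed
  have "kernel_of k f \<subseteq> int_seq.span G" using ker assms(2) by (auto simp: kernel_of_def)
  then have "int_seq.span (kernel_of k f) \<subseteq> int_seq.span G"
    by (intro int_seq.span_minimal int_seq.subspace_span)
  then obtain B where "finite B" "int_seq.span B = int_seq.span (kernel_of k f)"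
    using subspace_of_span_finite[OF assms(1) int_seq.subspace_span] by blast
  then show ?thesis by (auto simp: regular_def)
qed

section \<open>A finite automaton for the correction bits\<close>

text \<open>
  The truncated index makes the state determine \<open>n\<close> itself for \<open>n < 4\<close>. Thus every sequence
  is a function of the state there, which takes care of the arguments before the recursion sets
  in and of the arbitrary values of \<open>\<theta>\<close> and \<open>\<epsilon>\<^sub>4\<close>. The bit at \<open>n - 1\<close> is part of the state since
  \<open>corr (5 * n) = corr (n - 1)\<close> for \<open>n \<ge> 4\<close>.
\<close>
definition state :: "nat \<Rightarrow> nat \<times> int \<times> int \<times> int \<times> int \<times> int" where
  "state n = (min n 4, corr (int n - 1), corr (int n), corr (int n + 1), corr (int n + 2),
     corr (int n + 3))"

lemma finite_range_state: "finite (range state)"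
proof (rule finite_subset)
  show "range state \<subseteq> {..4} \<times> {0, 1} \<times> {0, 1} \<times> {0, 1} \<times> {0, 1} \<times> {0, 1}"
    by (intro image_subsetI; unfold state_def; intro SigmaI corr_01) simp
qed simp

lemma state_eq_cases:
  assumes "state m = state n"
  obtains "m = n" 
  | "m \<ge> 4" "n \<ge> 4" 
    "\<And>i. i \<in> {-1, 0, 1, 2, 3} \<Longrightarrow> corr (int m + i) = corr (int n + i)"
proof (cases "m < 4 \<or> n < 4")
  case True
  then have "m = n" using assms by (auto simp: state_def min_def split: if_splits)
  then show ?thesis by (rule that)
next
  case False
  then show ?thesis using assms by (intro that(2)) (auto simp: state_def)
qed

text \<open>
  The bits at \<open>5m - 1, \<dots>, 5m + 7\<close> are all those that occur in the states of
  \<open>5m, \<dots>, 5m + 4\<close>.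
\<close>
lemma corr_near:
  assumes "m \<ge> 4" "-1 \<le> i" "i \<le> 7"
  shows "corr (5 * m + i) =
    corr (m + (if i = 0 then -1 else if i \<in> {-1, 1, 3, 5} then 0 else if i = 7 then 2 else 1))"
proof -
  have "i \<in> {-1, 0, 1, 2, 3, 4, 5, 6, 7}" using assms by simp arith
  then show ?thesis
    using assms corr_rec[of m] corr_rec(5)[of "m - 1"] corr_rec(4)[of "m - 1"]
      corr_rec(1)[of "m + 1"] corr_rec(2)[of "m + 1"]
    by (elim insertE emptyE; simp add: algebra_simps)
qed

lemma state_step:
  assumes "j < 5" "state m = state n"
  shows "state (5 * m + j) = state (5 * n + j)"
  using assms(2)
proof (cases rule: state_eq_cases)
  case 2
  have "corr (5 * int m + i) = corr (5 * int n + i)" if "-1 \<le> i" "i \<le> 7" for i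
    using that 2 by (simp add: corr_near)
  from this[of "int j - 1"] this[of "int j"] this[of "int j + 1"] this[of "int j + 2"]
    this[of "int j + 3"]
  show ?thesis using 2(1,2) assms(1) by (simp add: state_def algebra_simps)
qed simp

lemma sum_apply: "(\<Sum>i\<in>A. f i) x = (\<Sum>i\<in>A. f i x)"
  for f :: "'i \<Rightarrow> 'a \<Rightarrow> 'b :: comm_monoid_add"
  by (induction A rule: infinite_finite_induct) simp_all

lemma in_span_if_state_function:
  assumes "\<And>m n. state m = state n \<Longrightarrow> f m = f n"
  shows "f \<in> int_seq.span ((\<lambda>s n. of_bool (state n = s)) ` range state)"
proof -
  have v: "f n = f (inv state (state n))" for n
    by (rule assms) (simp add: f_inv_into_f)
  have "f = (\<Sum>s\<in>range state. seq_scale (f (inv state s)) (\<lambda>n. of_bool (state n = s)))"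
  proof
    fix n
    have "(\<Sum>s\<in>range state. seq_scale (f (inv state s)) (\<lambda>n. of_bool (state n = s))) n =
        (\<Sum>s\<in>range state. if state n = s then f (inv state s) else 0)"
      by (auto simp: seq_scale_def sum_apply intro!: sum.cong)
    also have "\<dots> = f n"
      using finite_range_state v[of n] by simp
    finally show "f n = (\<Sum>s\<in>range state. seq_scale (f (inv state s)) (\<lambda>n. of_bool (state n = s))) n" ..
  qed
  also have "\<dots> \<in> int_seq.span ((\<lambda>s n. of_bool (state n = s)) ` range state)"
    by (intro int_seq.span_sum int_seq.span_scale int_seq.span_base) auto
  finally show ?thesis .
qed

text \<open>
  The shift by \<open>q = -1\<close> is needed because the module used for regularity contains the sequences
  \<open>gol (n - c)\<close>, and \<open>5n + j - c\<close> may fall into the block of \<open>n - 1\<close>.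
\<close>
lemma gol_block_state:
  assumes "state m = state n" "0 \<le> r" "r < 5" "q \<in> {-1, 0}"
  shows "gol (5 * (int m + q) + r) - TG (int m + q) = gol (5 * (int n + q) + r) - TG (int n + q)"
  using assms(1)
proof (cases rule: state_eq_cases)
  case 2
  define M N where "M = int m + q" and "N = int n + q"
  have c: "corr M = corr N" "corr (M + 1) = corr (N + 1)"
    using 2(3)[of q] 2(3)[of "q + 1"] assms(4) by (auto simp: M_def N_def add.assoc)
  have "r = 0 \<or> r = 1 \<or> r = 2 \<or> r = 3 \<or> r = 4" using assms(2,3) by arith
  moreover have "M \<ge> 3" "N \<ge> 3" using 2(1,2) assms(4) by (auto simp: M_def N_def)
  ultimately have "gol (5 * M + r) - TG M = gol (5 * N + r) - TG N"
    by (elim disjE) (simp_all add: gol_block c)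
  then show ?thesis by (simp only: M_def N_def)
qed simp

text \<open>
  Shifts \<open>c \<le> 5\<close> suffice: \<open>gol (5n + j - c)\<close> is \<open>TG (n - 1)\<close> or \<open>TG n\<close> up to a function of the state,
  and these two sums involve exactly \<open>gol n, \<dots>, gol (n - 5)\<close>.
\<close>
lemma regular_gol: "regular 5 (\<lambda>n. gol (int n))"
proof -
  define S where "S = (\<lambda>c n. gol (int n - c)) ` {0..5}"
  define G where "G = S \<union> (\<lambda>s n. of_bool (state n = s)) ` range state"
  have stateG: "f \<in> int_seq.span G" if "\<And>m n. state m = state n \<Longrightarrow> f m = f n" for f
  proof -
    have "f \<in> int_seq.span ((\<lambda>s n. of_bool (state n = s)) ` range state)"
      by (rule in_span_if_state_function) (rule that)
    moreover have "int_seq.span ((\<lambda>s n. of_bool (state n = s)) ` range state) \<subseteq> int_seq.span G"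
      unfolding G_def by (rule int_seq.span_mono) simp
    ultimately show ?thesis by blast
  qed
  have T: "(\<lambda>n. TG (int n + q)) \<in> int_seq.span G" if "q \<in> {-1, 0}" for q
  proof -
    have s: "(\<lambda>n. gol (int n + q - i)) \<in> int_seq.span G" if "0 \<le> i" "i \<le> 4" for i
    proof (rule int_seq.span_base)
      show "(\<lambda>n. gol (int n + q - i)) \<in> G"
        unfolding G_def S_def using \<open>q \<in> {-1, 0}\<close> that
        by (intro UnI1 image_eqI[of _ _ "i - q"]) (auto simp: algebra_simps)
    qed
    have "(\<lambda>n. TG (int n + q)) = (\<lambda>n. gol (int n + q - 0)) + (\<lambda>n. gol (int n + q - 1))
        + (\<lambda>n. gol (int n + q - 2)) + (\<lambda>n. gol (int n + q - 3)) + (\<lambda>n. gol (int n + q - 4))"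
      by (simp add: T5_of_def plus_fun_def)
    also have "\<dots> \<in> int_seq.span G"
      by (intro int_seq.span_add s) simp_all
    finally show ?thesis .
  qed
  show ?thesis
  proof (rule regularI)
    show "finite G" by (simp add: G_def S_def finite_range_state)
    have "(\<lambda>n. gol (int n)) = (\<lambda>n. gol (int n - 0))" by simp
    then have "(\<lambda>n. gol (int n)) \<in> S" unfolding S_def by (rule image_eqI) simp
    then show "(\<lambda>n. gol (int n)) \<in> int_seq.span G"
      by (intro int_seq.span_base) (simp add: G_def)
  next
    fix g j
    assume "g \<in> G" and j: "j < (5 :: nat)"
    from \<open>g \<in> G\<close> consider c where "0 \<le> c" "c \<le> 5" "g = (\<lambda>n. gol (int n - c))"
      | s where "g = (\<lambda>n. of_bool (state n = s))"
      unfolding G_def S_def by (elim UnE imageE) (simp add: atLeastAtMost_iff, blast)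
    then show "(\<lambda>n. g (5 * n + j)) \<in> int_seq.span G"
    proof cases
      case 1
      define q r where "q = (int j - c) div 5" and "r = (int j - c) mod 5"
      have r: "0 \<le> r" "r < 5" "int j - c = 5 * q + r" by (simp_all add: q_def r_def)
      have q: "q \<in> {-1, 0}" using r 1 j by simp arith
      have "(\<lambda>n. g (5 * n + j)) = (\<lambda>n. TG (int n + q))
          + (\<lambda>n. gol (5 * (int n + q) + r) - TG (int n + q))"
      proof
        fix n
        have "int (5 * n + j) - c = 5 * (int n + q) + r" using r(3) by simp
        then show "g (5 * n + j) = ((\<lambda>n. TG (int n + q))
          + (\<lambda>n. gol (5 * (int n + q) + r) - TG (int n + q))) n"
          by (simp only: 1 plus_fun_apply)
      qed
      also have "\<dots> \<in> int_seq.span G"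
        by (intro int_seq.span_add T q stateG gol_block_state r)
      finally show ?thesis .
    next
      case 2
      show ?thesis unfolding 2 using state_step[OF j] by (intro stateG) metis
    qed
  qed
qed

lemma automatic_if_window:
  assumes window: "\<And>n. n \<ge> 3 \<Longrightarrow> f n = F (corr (int n + 1)) (corr (int n + 2)) (corr (int n + 3))"
  shows "automatic 5 f"
proof (rule automaticI[OF finite_range_state state_step])
  fix m n
  assume "state m = state n"
  then show "f m = f n"
  proof (cases rule: state_eq_cases)
    case 2
    then show ?thesis using window[of m] window[of n] by simp
  qed simp
qed

section \<open>The identities and the tables\<close>

theorem theorem6p3:
  fixes \<theta> \<epsilon>4 :: "nat \<Rightarrow> int"
  assumes theta_def: "\<forall>n\<ge>3. ag5 (5 * int n + 3) = T5 (int n + 3) - 4 + \<theta> n"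
    and eps4_def: "\<forall>n\<ge>3. ag5 (5 * int n + 4) = T5 (int n + 4) - 2 + \<epsilon>4 n"
  shows
    "(\<forall>n\<ge>3.
        ag5 (5 * int n)     = T5 (int n) + 2 + eps n \<and>
        ag5 (5 * int n + 1) = T5 (int n + 1) + 1 - eps n \<and>
        ag5 (5 * int n + 2) = T5 (int n + 2) - 1 - eta n \<and>
        ag5 (5 * int n + 3) = T5 (int n + 3) - 4 + \<theta> n \<and>
        ag5 (5 * int n + 4) = T5 (int n + 4) - 2 + \<epsilon>4 n \<and>
        \<theta> n \<in> {0, 1} \<and> \<epsilon>4 n \<in> {-4, -3, -2})
   \<and> automatic 5 \<theta> \<and> automatic 5 \<epsilon>4
   \<and> (\<forall>m\<ge>3.
        let W = (U (m - 1), U m);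
            L = [\<theta> (5*m), \<theta> (5*m + 1), \<theta> (5*m + 2), \<theta> (5*m + 3), \<theta> (5*m + 4)]
        in (W \<in> {((0,0),(0,0)), ((1,0),(0,0))} \<longrightarrow> L = [1,1,1,1,1]) \<and>
           (W \<in> {((0,0),(0,1)), ((1,0),(0,1))} \<longrightarrow> L = [0,1,0,1,0]) \<and>
           (W = ((0,1),(1,0)) \<longrightarrow> L = [1,0,1,0,1]) \<and>
           W \<in> {((0,0),(0,0)), ((1,0),(0,0)), ((0,0),(0,1)), ((1,0),(0,1)), ((0,1),(1,0))})
   \<and> (\<forall>m\<ge>3.
        (\<forall>d\<in>{0,2}. \<epsilon>4 (5*m + d) = -2 - sigma m - eps m) \<and>
        (\<forall>d\<in>{1,3}. \<epsilon>4 (5*m + d) = -2 - sigma m - eta m) \<and>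
        (let V = (U m, U (m + 1))
         in (V = ((0,0),(0,0)) \<longrightarrow> \<epsilon>4 (5*m + 4) = -2) \<and>
            (V \<in> {((0,0),(0,1)), ((0,1),(1,0)), ((1,0),(0,0))} \<longrightarrow> \<epsilon>4 (5*m + 4) = -3) \<and>
            (V = ((1,0),(0,1)) \<longrightarrow> \<epsilon>4 (5*m + 4) = -4)))
   \<and> regular 5 (\<lambda>n. ag5 (int n))"
proof -
  have \<theta>: "\<theta> n = 1 - corr (int n + 2)" if "n \<ge> 3" for n
    using that theta_def gol_block(4)[of "int n"] TG_shift(2)[of "int n"] by (simp add: ag5_eq_gol)
  have \<epsilon>4: "\<epsilon>4 n = -2 - corr (int n + 1) - corr (int n + 2) - corr (int n + 3)" if "n \<ge> 3" for n
    using that eps4_def gol_block(5)[of "int n"] TG_shift(3)[of "int n"] by (simp add: ag5_eq_gol)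
  have bit: "corr i = 0 \<or> corr i = 1" for i using corr_01[of i] by simp
  have cc: "corr i = 0 \<or> corr (i + 1) = 0" for i using corr_no_consecutive[of i] by simp
  have rec: "corr (5 * int m + 1) = corr m" "corr (5 * int m + 2) = corr (int m + 1)"
    "corr (5 * int m + 3) = corr m" "corr (5 * int m + 4) = corr (int m + 1)"
    "corr (5 * int m + 5) = corr m" "corr (5 * int m + 6) = corr (int m + 1)"
    "corr (5 * int m + 7) = corr (int m + 2)" if "m \<ge> 3" for m :: nat
    using that corr_rec[of "int m"] corr_rec(1,2)[of "int m + 1"] by (simp_all add: algebra_simps)
  have "\<theta> n \<in> {0, 1}" "\<epsilon>4 n \<in> {-4, -3, -2}" if "n \<ge> 3" for n
    using \<theta>[OF that] \<epsilon>4[OF that] bit[of "int n + 1"] bit[of "int n + 2"] bit[of "int n + 3"]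
      cc[of "int n + 1"] by (auto simp: add.commute)
  moreover have "automatic 5 \<theta>" using \<theta> by (rule automatic_if_window)
  moreover have "automatic 5 \<epsilon>4" using \<epsilon>4 by (rule automatic_if_window)
  moreover have "let W = (U (m - 1), U m);
            L = [\<theta> (5*m), \<theta> (5*m + 1), \<theta> (5*m + 2), \<theta> (5*m + 3), \<theta> (5*m + 4)]
        in (W \<in> {((0,0),(0,0)), ((1,0),(0,0))} \<longrightarrow> L = [1,1,1,1,1]) \<and>
           (W \<in> {((0,0),(0,1)), ((1,0),(0,1))} \<longrightarrow> L = [0,1,0,1,0]) \<and>
           (W = ((0,1),(1,0)) \<longrightarrow> L = [1,0,1,0,1]) \<and>
           W \<in> {((0,0),(0,0)), ((1,0),(0,0)), ((0,0),(0,1)), ((1,0),(0,1)), ((0,1),(1,0))}"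
    if "m \<ge> 3" for m
  proof -
    have "U (m - 1) = (corr (int m - 1), corr m)" "U m = (corr m, corr (int m + 1))"
      using that by (simp_all add: U_def eps_eq eta_eq of_nat_diff)
    moreover have "\<theta> (5 * m) = 1 - corr (int m + 1)" "\<theta> (5 * m + 1) = 1 - corr m"
      "\<theta> (5 * m + 2) = 1 - corr (int m + 1)" "\<theta> (5 * m + 3) = 1 - corr m"
      "\<theta> (5 * m + 4) = 1 - corr (int m + 1)"
      using that rec[of m] by (simp_all add: \<theta> add.commute)
    ultimately show ?thesis
      using bit[of "int m - 1"] bit[of m] bit[of "int m + 1"] cc[of "int m - 1"] cc[of m]
      by (auto simp: Let_def)
  qed
  moreover have "(\<forall>d\<in>{0,2}. \<epsilon>4 (5*m + d) = -2 - sigma m - eps m) \<and>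
        (\<forall>d\<in>{1,3}. \<epsilon>4 (5*m + d) = -2 - sigma m - eta m) \<and>
        (let V = (U m, U (m + 1))
         in (V = ((0,0),(0,0)) \<longrightarrow> \<epsilon>4 (5*m + 4) = -2) \<and>
            (V \<in> {((0,0),(0,1)), ((0,1),(1,0)), ((1,0),(0,0))} \<longrightarrow> \<epsilon>4 (5*m + 4) = -3) \<and>
            (V = ((1,0),(0,1)) \<longrightarrow> \<epsilon>4 (5*m + 4) = -4))"
    if "m \<ge> 3" for m
  proof -
    have "U m = (corr m, corr (int m + 1))" "U (m + 1) = (corr (int m + 1), corr (int m + 2))"
      "sigma m = corr m + corr (int m + 1)" "eps m = corr m" "eta m = corr (int m + 1)"
      by (simp_all add: U_def sigma_def eps_eq eta_eq algebra_simps)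
    moreover have "\<epsilon>4 (5 * m) = -2 - 2 * corr m - corr (int m + 1)"
      "\<epsilon>4 (5 * m + 1) = -2 - corr m - 2 * corr (int m + 1)"
      "\<epsilon>4 (5 * m + 2) = -2 - 2 * corr m - corr (int m + 1)"
      "\<epsilon>4 (5 * m + 3) = -2 - corr m - 2 * corr (int m + 1)"
      "\<epsilon>4 (5 * m + 4) = -2 - corr m - corr (int m + 1) - corr (int m + 2)"
      using that rec[of m] by (simp_all add: \<epsilon>4 add.commute)
    ultimately show ?thesis by (auto simp: Let_def)
  qed
  moreover have "ag5 (5 * int n) = T5 (int n) + 2 + eps n"
    "ag5 (5 * int n + 1) = T5 (int n + 1) + 1 - eps n"
    "ag5 (5 * int n + 2) = T5 (int n + 2) - 1 - eta n" if "n \<ge> 3" for n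
    using that gol_block[of "int n"] TG_step[of "int n"] TG_shift(1)[of "int n"]
    by (simp_all add: ag5_eq_gol eps_eq eta_eq)
  moreover have "regular 5 (\<lambda>n. ag5 (int n))" by (simp add: ag5_eq_gol regular_gol)
  ultimately show ?thesis using theta_def eps4_def by blast
qed

end
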